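(* For $\psi\in\mathbb{T}^2$ and $t>0$ define $$V_{\varepsilon}(\psi,t):=\frac{H_\varepsilon(\psi+tv_-)-H_\varepsilon(\psi)}{t},\qquad V_\alpha(\psi,t):=V_\varepsilon(\psi,t)\cdot v_\alpha\quad(\alpha\in\{+,-\}).$$ Then there exists $D>0$ such that for $|\varepsilon|<D$ (and every $\psi\in\mathbb{T}^2$) the limit $$v_\varepsilon(\psi):=\lim_{t\to0}\frac{V_+(\psi,t)}{V_-(\psi,t)}$$ exists.
   Context: $\mathbb{T}^2=\mathbb{R}^2/2\pi\mathbb{Z}^2$. Let $S_0=\begin{bmatrix}1&1\\1&0\end{bmatrix}$, with eigenvalues $\lambda_\pm=\frac{1\pm\sqrt5}{2}$ and corresponding unit eigenvectors $v_\pm$ (which are orthogonal), and let $S:\mathbb{T}^2\to\mathbb{T}^2$, $S(\psi)=S_0\psi \pmod{2\pi}$. Let $f:\mathbb{T}^2\to\mathbb{R}^2$ be a trigonometric polynomial, $f(x)=\sum_{n\in\mathbb{Z}^2,|n|<N}c_n e^{in\cdot x}$ with vector coefficients $c_n$, and let $S_\varepsilon(x)=S_0x-\varepsilon f(x)\pmod{2\pi}$. Known fact (structural stability) which defines $H_\varepsilon$: for every $\beta\in(0,1)$ there are $C<\infty$ and $\varepsilon_0>0$ such that for each $\varepsilon\in(-\varepsilon_0,\varepsilon_0)$ there is a unique homeomorphism $H_\varepsilon:\mathbb{T}^2\to\mathbb{T}^2$ with $H_\varepsilon S H_\varepsilon^{-1}=S_\varepsilon$, $H_0=\mathrm{id}$,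 such that $H_\varepsilon$ is Hölder continuous with exponent $\beta$ and modulus $C$, and $\varepsilon\mapsto H_\varepsilon(\psi)$ is analytic for all $\psi$. It has an expansion $H_\varepsilon(\psi)=\psi+\varepsilon h^{(1)}(\psi)+\varepsilon^2h^{(2)}(\psi)+\cdots$ with $h^{(k)}:\mathbb{T}^2\to\mathbb{R}^2$; the difference $H_\varepsilon(\psi+tv_-)-H_\varepsilon(\psi)$ is understood as the vector $tv_-+\sum_{k\ge1}\varepsilon^k\,[h^{(k)}(\psi+tv_-)-h^{(k)}(\psi)]\in\mathbb{R}^2$. The limit is taken over $t>0$. *)

theory Defs
  imports "HOL-Analysis.Analysis"
begin

definition torus_rel :: "real^2 \<Rightarrow> real^2 \<Rightarrow> bool" where
  "torus_rel x y \<longleftrightarrow> (\<forall>i. \<exists>m::int. x $ i - y $ i = 2 * pi * of_int m)"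

lemma torus_rel_refl: "torus_rel x x"
  unfolding torus_rel_def by (auto intro: exI[of _ 0])

lemma torus_rel_sym: "torus_rel x y \<Longrightarrow> torus_rel y x"
  unfolding torus_rel_def
proof
  fix i assume "\<forall>i. \<exists>m::int. x $ i - y $ i = 2 * pi * of_int m"
  then obtain m :: int where "x $ i - y $ i = 2 * pi * of_int m" by blast
  then show "\<exists>m::int. y $ i - x $ i = 2 * pi * of_int m"
    by (intro exI[of _ "-m"]) (simp add: algebra_simps)
qed

lemma torus_rel_add:
  assumes "torus_rel x x'" "torus_rel y y'" shows "torus_rel (x + y) (x' + y')"
  unfolding torus_rel_def
proof
  fix i
  obtain m n :: int where "x $ i - x' $ i = 2 * pi * of_int m" "y $ i - y' $ i = 2 * pi * of_int n"
    using assms unfolding torus_rel_def by blast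
  then show "\<exists>m::int. (x + y) $ i - (x' + y') $ i = 2 * pi * of_int m"
    by (intro exI[of _ "m + n"]) (simp add: algebra_simps)
qed

lemma torus_rel_minus:
  assumes "torus_rel x y" shows "torus_rel (- x) (- y)"
  using torus_rel_sym[OF assms] unfolding torus_rel_def by simp

lemma torus_rel_trans: "torus_rel x y \<Longrightarrow> torus_rel y z \<Longrightarrow> torus_rel x z"
  using torus_rel_add[of x y y z] unfolding torus_rel_def by simp

quotient_type torus2 = "real^2" / torus_rel
  morphisms rep_torus2 torus_proj
  by (rule equivpI; unfold reflp_def symp_def transp_def)
     (blast intro: torus_rel_refl torus_rel_sym torus_rel_trans)+

instantiation torus2 :: ab_group_add
begin

lift_definition zero_torus2 :: torus2 is 0 .
lift_definition plus_torus2 :: "torus2 \<Rightarrow> torus2 \<Rightarrow> torus2" is "(+)" by (rule torus_rel_add)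
lift_definition uminus_torus2 :: "torus2 \<Rightarrow> torus2" is uminus by (rule torus_rel_minus)
lift_definition minus_torus2 :: "torus2 \<Rightarrow> torus2 \<Rightarrow> torus2" is "(-)"
  by (simp only: diff_conv_add_uminus torus_rel_add torus_rel_minus)

instance
  by standard (transfer; simp add: algebra_simps torus_rel_refl)+

end

lemma torus_proj_add: "torus_proj (x + y) = torus_proj x + torus_proj y"
  by (simp add: plus_torus2.abs_eq)

lemma torus_proj_diff: "torus_proj (x - y) = torus_proj x - torus_proj y"
  by (simp add: minus_torus2.abs_eq)

lemma torus_proj_minus: "torus_proj (- x) = - torus_proj x"
  by (simp add: uminus_torus2.abs_eq)

lemma torus_proj_zero: "torus_proj 0 = 0"
  by (simp add: zero_torus2.abs_eq)

lemma torus_proj_eq_iff: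
  "torus_proj x = torus_proj y \<longleftrightarrow> (\<forall>i. \<exists>m::int. x $ i - y $ i = 2 * pi * of_int m)"
  by (simp add: torus2.abs_eq_iff torus_rel_def)

lemma torus_proj_surj: "\<exists>x. p = torus_proj x"
  using Quotient3_abs_rep[OF Quotient3_torus2] by metis

lemma torus_proj_small_unique:
  assumes "torus_proj x = torus_proj y" "norm (x - y) < 2 * pi"
  shows "x = y"
proof -
  have "x $ i = y $ i" for i
  proof -
    obtain m :: int where m: "x $ i - y $ i = 2 * pi * of_int m"
      using assms(1) unfolding torus_proj_eq_iff by blast
    have "\<bar>x $ i - y $ i\<bar> < 2 * pi"
      using component_le_norm_cart[of "x - y" i] assms(2) by simp
    then have "2 * pi * \<bar>of_int m :: real\<bar> < 2 * pi * 1"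
      by (simp add: m abs_mult)
    then have "\<bar>of_int m :: real\<bar> < 1" by simp
    then have "m = 0" by linarith
    with m show ?thesis by simp
  qed
  then show ?thesis by (simp add: vec_eq_iff)
qed

instantiation torus2 :: metric_space
begin

definition dist_torus2 :: "torus2 \<Rightarrow> torus2 \<Rightarrow> real" where
  "dist_torus2 p q = Inf {dist x y |x y. torus_proj x = p \<and> torus_proj y = q}"

definition uniformity_torus2 :: "(torus2 \<times> torus2) filter" where
  "uniformity_torus2 = (INF e\<in>{0<..}. principal {(x, y). dist x y < e})"

definition open_torus2 :: "torus2 set \<Rightarrow> bool" where
  "open_torus2 U \<longleftrightarrow> (\<forall>x\<in>U. eventually (\<lambda>(x', y). x' = x \<longrightarrow> y \<in> U) uniformity)"

lemma dist_torus2_le: "dist (torus_proj x) (torus_proj y) \<le> dist x y"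
  unfolding dist_torus2_def by (rule cInf_lower) (auto intro!: bdd_belowI[of _ 0])

lemma dist_torus2_nonneg: "0 \<le> dist (p::torus2) q"
  unfolding dist_torus2_def
  using torus_proj_surj[of p] torus_proj_surj[of q]
  by (intro cInf_greatest) auto

lemma dist_torus2_less:
  assumes "dist p q < e"
  obtains x y where "torus_proj x = p" "torus_proj y = q" "dist x y < e"
proof -
  have "{dist x y |x y. torus_proj x = p \<and> torus_proj y = q} \<noteq> {}"
    using torus_proj_surj[of p] torus_proj_surj[of q] by auto
  from cInf_lessD[OF this assms[unfolded dist_torus2_def]] that show ?thesis by auto
qed

instance
proof
  show "uniformity = (INF e\<in>{0<..}. principal {(x, y :: torus2). dist x y < e})"
    by (rule uniformity_torus2_def)
  show "open U \<longleftrightarrow> (\<forall>x\<in>U. \<forall>\<^sub>F (x', y) in uniformity. x' = x \<longrightarrow> y \<in> U)" for U :: "torus2 set"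
    by (rule open_torus2_def)
  show "dist p q = 0 \<longleftrightarrow> p = q" for p q :: torus2
  proof
    assume 0: "dist p q = 0"
    obtain x y where xy: "torus_proj x = p" "torus_proj y = q" "dist x y < 1"
      using dist_torus2_less[of p q 1] 0 by auto
    have "norm (x - y) \<le> e" if "e > 0" for e
    proof -
      have "dist p q < min e 1" using 0 that by simp
      then obtain x' y' where xy': "torus_proj x' = p" "torus_proj y' = q" "dist x' y' < min e 1"
        by (rule dist_torus2_less)
      have "norm ((x - y) - (x' - y')) \<le> norm (x - y) + norm (x' - y')"
        by (rule norm_triangle_ineq4)
      also have "\<dots> < 2 * pi"
        using xy(3) xy'(3) pi_gt3 by (simp add: dist_norm)
      finally have "x - y = x' - y'"
        using xy xy' by (intro torus_proj_small_unique) (auto simp: torus_proj_diff)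
      then show ?thesis using xy' by (simp add: dist_norm)
    qed
    then have "norm (x - y) \<le> 0" using field_le_epsilon[of "norm (x - y)" 0] by simp
    then show "p = q" using xy by simp
  next
    assume "p = q"
    obtain x where "p = torus_proj x" using torus_proj_surj by blast
    with \<open>p = q\<close> show "dist p q = 0"
      using dist_torus2_le[of x x] dist_torus2_nonneg[of p q] by simp
  qed
  show "dist p q \<le> dist p r + dist q r" for p q r :: torus2
  proof (rule field_le_epsilon)
    fix e :: real assume "e > 0"
    obtain x z where xz: "torus_proj x = p" "torus_proj z = r" "dist x z < dist p r + e / 2"
      using dist_torus2_less[of p r "dist p r + e / 2"] \<open>e > 0\<close> by auto
    obtain y w where yw: "torus_proj y = q" "torus_proj w = r" "dist y w < dist q r + e / 2"
      using dist_torus2_less[of q r "dist q r + e / 2"] \<open>e > 0\<close> by auto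
    have "dist p q \<le> dist x (y + (z - w))"
      using dist_torus2_le[of x "y + (z - w)"] xz yw by (simp add: torus_proj_add torus_proj_diff)
    also have "\<dots> = norm ((x - z) - (y - w))"
      by (simp add: dist_norm algebra_simps)
    also have "\<dots> \<le> dist x z + dist y w"
      unfolding dist_norm by (rule norm_triangle_ineq4)
    finally show "dist p q \<le> dist p r + dist q r + e" using xz yw by simp
  qed
qed

end

definition S0 :: "real^2^2" where
  "S0 = vector [vector [1, 1], vector [1, 0]]"

definition lambda_plus :: real where "lambda_plus = (1 + sqrt 5) / 2"

definition lambda_minus :: real where "lambda_minus = (1 - sqrt 5) / 2"

lift_definition cat_map :: "torus2 \<Rightarrow> torus2" is "\<lambda>x. S0 *v x"
proof -
  fix x y :: "real^2" assume "torus_rel x y"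
  then obtain m n :: int where "x $ 1 - y $ 1 = 2 * pi * of_int m" "x $ 2 - y $ 2 = 2 * pi * of_int n"
    unfolding torus_rel_def by blast
  then have "(S0 *v x) $ 1 - (S0 *v y) $ 1 = 2 * pi * of_int (m + n)"
    and "(S0 *v x) $ 2 - (S0 *v y) $ 2 = 2 * pi * of_int m"
    by (simp_all add: S0_def matrix_vector_mult_def sum_2 algebra_simps)
  then show "torus_rel (S0 *v x) (S0 *v y)"
    unfolding torus_rel_def forall_2 by blast
qed

definition perturbed_cat_map :: "(torus2 \<Rightarrow> real^2) \<Rightarrow> real \<Rightarrow> torus2 \<Rightarrow> torus2" where
  "perturbed_cat_map f \<epsilon> \<psi> = cat_map \<psi> - torus_proj (\<epsilon> *\<^sub>R f \<psi>)"

definition of_int_vec :: "int^2 \<Rightarrow> real^2" where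
  "of_int_vec n = (\<chi> i. of_int (n $ i))"

definition trig_polynomial :: "(torus2 \<Rightarrow> real^2) \<Rightarrow> bool" where
  "trig_polynomial f \<longleftrightarrow>
     (\<exists>(N::real) (c :: int^2 \<Rightarrow> complex^2). \<forall>x j.
        complex_of_real (f (torus_proj x) $ j) =
          (\<Sum>n | norm (of_int_vec n) < N. c n $ j * exp (\<i> * complex_of_real (of_int_vec n \<bullet> x))))"

text \<open>
  The family \<open>H\<close> given by structural stability, together with the coefficients
  \<open>h k\<close> (\<open>k \<ge> 1\<close>; \<open>h 0\<close> is never used) of its expansion in \<open>\<epsilon>\<close>. Analyticity of
  \<open>\<epsilon> \<mapsto> H \<epsilon> \<psi>\<close> is expressed by convergence of this expansion on the whole interval.
\<close>

definition structural_conjugacy ::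
  "(torus2 \<Rightarrow> real^2) \<Rightarrow> (real \<Rightarrow> torus2 \<Rightarrow> torus2) \<Rightarrow> (nat \<Rightarrow> torus2 \<Rightarrow> real^2) \<Rightarrow> bool" where
  "structural_conjugacy f H h \<longleftrightarrow>
     H 0 = id \<and>
     (\<forall>\<beta>::real. 0 < \<beta> \<and> \<beta> < 1 \<longrightarrow>
       (\<exists>C::real. \<exists>\<epsilon>0>0. \<forall>\<epsilon>. \<bar>\<epsilon>\<bar> < \<epsilon>0 \<longrightarrow>
          (\<exists>G. homeomorphism UNIV UNIV (H \<epsilon>) G) \<and>
          H \<epsilon> \<circ> cat_map \<circ> inv (H \<epsilon>) = perturbed_cat_map f \<epsilon> \<and>
          (\<forall>\<phi> \<psi>. dist (H \<epsilon> \<phi>) (H \<epsilon> \<psi>) \<le> C * dist \<phi> \<psi> powr \<beta>) \<and>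
          (\<forall>\<psi>. summable (\<lambda>k. \<epsilon> ^ Suc k *\<^sub>R h (Suc k) \<psi>) \<and>
               H \<epsilon> \<psi> = \<psi> + torus_proj (\<Sum>k. \<epsilon> ^ Suc k *\<^sub>R h (Suc k) \<psi>))))"

text \<open>
  \<open>V_quot h v \<epsilon> \<psi> t\<close> is the difference quotient of \<open>H \<epsilon>\<close> at \<open>\<psi>\<close> in direction \<open>v\<close>; the difference
  of the two torus points is lifted to a vector of the plane by means of the expansion.
\<close>

definition V_quot :: "(nat \<Rightarrow> torus2 \<Rightarrow> real^2) \<Rightarrow> real^2 \<Rightarrow> real \<Rightarrow> torus2 \<Rightarrow> real \<Rightarrow> real^2" where
  "V_quot h v \<epsilon> \<psi> t = (1 / t) *\<^sub>R
     (t *\<^sub>R v + (\<Sum>k. \<epsilon> ^ Suc k *\<^sub>R (h (Suc k) (\<psi> + torus_proj (t *\<^sub>R v)) - h (Suc k) \<psi>)))"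

end

theory Submission
  imports Defs
begin

text \<open>
  Lifted to the plane, the conjugacy becomes a continuous map \<open>G\<close> at bounded distance from the
  identity with \<open>G (S0 x) = S0 (G x) - \<epsilon> F (G x)\<close>. The increment \<open>G (x + t v) - G x\<close> along the
  contracted direction \<open>v\<close> stays bounded under forward iteration, so it can never enter the unstable
  cone: its slope is bounded by \<open>1\<close>. The slope at \<open>(x, t)\<close> is, up to an error that vanishes as
  \<open>t \<rightarrow> 0\<close>, a contracting function of the slope at \<open>(S0 x, \<kappa> t)\<close>. Hence the oscillation of the slope
  as \<open>t \<rightarrow> 0\<close> is at most half the oscillation at the next point of the orbit, and therefore zero.
\<close>

section \<open>Slopes of increments along the contracted direction\<close>

text \<open>\<open>w\<close> and \<open>v\<close> are the expanding and contracting unit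
  eigenvectors. \<open>8/5\<close> and \<open>31/50\<close> are rational bounds for the golden ratio
  and its inverse; \<open>1/20\<close> is the room left for the perturbation in the cone and
  contraction estimates.\<close>

locale perturbed_hyperbolic_conjugacy =
  fixes S F G :: "'a::real_inner \<Rightarrow> 'a" and F' :: "'a \<Rightarrow> 'a \<Rightarrow> 'a"
    and w v :: 'a and \<mu> \<kappa> \<epsilon> L B \<rho> :: real
  assumes linear_S: "linear S"
    and norm_w: "norm w = 1" and norm_v: "norm v = 1"
    and expand: "\<And>z. z = (z \<bullet> w) *\<^sub>R w + (z \<bullet> v) *\<^sub>R v"
    and S_w: "\<And>z. S z \<bullet> w = \<mu> * (z \<bullet> w)" and S_v: "\<And>z. S z \<bullet> v = \<kappa> * (z \<bullet> v)"
    and S_eigen: "S v = \<kappa> *\<^sub>R v"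
    and mu: "8/5 \<le> \<mu>" and lambda: "\<kappa> \<noteq> 0" "\<bar>\<kappa>\<bar> \<le> 31/50"
    and deriv_F: "\<And>x. (F has_derivative F' x) (at x)"
    and deriv_F_bound: "\<And>x z. norm (F' x z) \<le> L * norm z"
    and small: "\<bar>\<epsilon>\<bar> * L \<le> 1/20"
    and G_close: "\<And>x. norm (G x - x) \<le> B"
    and G_cont: "\<And>x. isCont G x"
    and G_eq: "\<And>x. G (S x) = S (G x) - \<epsilon> *\<^sub>R F (G x)"
    and rho: "0 < \<rho>"
    and G_inj: "\<And>x t. 0 < \<bar>t\<bar> \<Longrightarrow> \<bar>t\<bar> < \<rho> \<Longrightarrow> G (x + t *\<^sub>R v) \<noteq> G x"
begin

definition incr :: "'a \<Rightarrow> real \<Rightarrow> 'a" where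
  "incr x t = G (x + t *\<^sub>R v) - G x"

definition force_incr :: "'a \<Rightarrow> real \<Rightarrow> 'a" where
  "force_incr x t = F (G x + incr x t) - F (G x)"

text \<open>This is the ratio of \<open>V_+\<close> to \<open>V_-\<close>, since the factor
  \<open>1 / t\<close> cancels. A vanishing denominator gives the value 0.\<close>

definition slope :: "'a \<Rightarrow> real \<Rightarrow> real" where
  "slope x t = (incr x t \<bullet> w) / (incr x t \<bullet> v)"

lemma L_nonneg: "0 \<le> L"
proof -
  have "0 \<le> norm (F' 0 v)" by simp
  also have "\<dots> \<le> L" using deriv_F_bound[of 0 v] norm_v by simp
  finally show ?thesis .
qed

lemma norm_le: "norm z \<le> \<bar>z \<bullet> w\<bar> + \<bar>z \<bullet> v\<bar>"
proof -
  have "norm z = norm ((z \<bullet> w) *\<^sub>R w + (z \<bullet> v) *\<^sub>R v)" using expand[of z] by simp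
  also have "\<dots> \<le> norm ((z \<bullet> w) *\<^sub>R w) + norm ((z \<bullet> v) *\<^sub>R v)" by (rule norm_triangle_ineq)
  finally show ?thesis by (simp add: norm_w norm_v)
qed

lemma inner_w_le: "\<bar>z \<bullet> w\<bar> \<le> norm z"
  using Cauchy_Schwarz_ineq2[of z w] by (simp add: norm_w)

lemma inner_v_le: "\<bar>z \<bullet> v\<bar> \<le> norm z"
  using Cauchy_Schwarz_ineq2[of z v] by (simp add: norm_v)

text \<open>As \<open>v\<close> is an eigenvector, \<open>S\<close> carries the segment at
  \<open>x\<close> of length parameter \<open>t\<close> to the one at \<open>S x\<close> with
  parameter \<open>\<kappa> * t\<close>; the conjugacy equations at its two ends are
  subtracted.\<close>

lemma incr_step: "incr (S x) (\<kappa> * t) = S (incr x t) - \<epsilon> *\<^sub>R force_incr x t"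
proof -
  have "S x + (\<kappa> * t) *\<^sub>R v = S (x + t *\<^sub>R v)"
    using linear_S by (simp add: linear_add linear_scale S_eigen mult.commute)
  then show ?thesis
    unfolding incr_def force_incr_def
    by (simp add: G_eq linear_diff[OF linear_S] algebra_simps)
qed

lemma incr_step_w: "incr (S x) (\<kappa> * t) \<bullet> w = \<mu> * (incr x t \<bullet> w) - \<epsilon> * (force_incr x t \<bullet> w)"
  by (simp add: incr_step inner_diff_left S_w)

lemma incr_step_v: "incr (S x) (\<kappa> * t) \<bullet> v = \<kappa> * (incr x t \<bullet> v) - \<epsilon> * (force_incr x t \<bullet> v)"
  by (simp add: incr_step inner_diff_left S_v)

lemma norm_force_incr: "norm (force_incr x t) \<le> L * norm (incr x t)"
proof -
  have "norm (F (G x + incr x t) - F (G x)) \<le> L * norm (G x + incr x t - G x)"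
  proof (rule differentiable_bound[of UNIV F F'])
    show "(F has_derivative F' y) (at y within UNIV)" for y using deriv_F by simp
    show "onorm (F' y) \<le> L" for y using onorm_bound[OF L_nonneg deriv_F_bound] .
  qed auto
  then show ?thesis by (simp add: force_incr_def)
qed

lemma eps_force_incr: "\<bar>\<epsilon>\<bar> * norm (force_incr x t) \<le> norm (incr x t) / 20"
proof -
  have "\<bar>\<epsilon>\<bar> * norm (force_incr x t) \<le> \<bar>\<epsilon>\<bar> * (L * norm (incr x t))"
    using norm_force_incr by (rule mult_left_mono) simp
  also have "\<dots> = (\<bar>\<epsilon>\<bar> * L) * norm (incr x t)" by simp
  also have "\<dots> \<le> (1/20) * norm (incr x t)" using small by (rule mult_right_mono) simp
  finally show ?thesis by simp
qed

text \<open>\<open>G\<close> moves each point by at most \<open>B\<close>. The bound does not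
  involve \<open>x\<close>, so it persists along the whole forward orbit and rules out exponential
  growth.\<close>

lemma norm_incr_le: "norm (incr x t) \<le> \<bar>t\<bar> + 2 * B"
proof -
  have "incr x t = (G (x + t *\<^sub>R v) - (x + t *\<^sub>R v)) - (G x - x) + t *\<^sub>R v"
    by (simp add: incr_def)
  also have "norm \<dots> \<le> norm ((G (x + t *\<^sub>R v) - (x + t *\<^sub>R v)) - (G x - x)) + norm (t *\<^sub>R v)"
    by (rule norm_triangle_ineq)
  also have "\<dots> \<le> norm (G (x + t *\<^sub>R v) - (x + t *\<^sub>R v)) + norm (G x - x) + norm (t *\<^sub>R v)"
    by (intro add_right_mono norm_triangle_ineq4)
  also have "\<dots> \<le> B + B + \<bar>t\<bar>"
    using G_close by (intro add_mono) (auto simp: norm_v)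
  finally show ?thesis by simp
qed

section \<open>Invariance of the unstable cone\<close>

text \<open>In the unstable cone the norm is at most twice the \<open>w\<close>-component, so the
  perturbation costs at most a tenth of it. The \<open>w\<close>-component grows by at least
  \<open>8/5 - 1/10 = 3/2\<close>, while the \<open>v\<close>-component ends below
  \<open>31/50 + 1/10\<close> of the old \<open>w\<close>-component.\<close>

lemma cone_step:
  assumes "\<bar>incr x t \<bullet> v\<bar> < \<bar>incr x t \<bullet> w\<bar>"
  shows "\<bar>incr (S x) (\<kappa> * t) \<bullet> v\<bar> < \<bar>incr (S x) (\<kappa> * t) \<bullet> w\<bar>"
    and "3/2 * \<bar>incr x t \<bullet> w\<bar> \<le> \<bar>incr (S x) (\<kappa> * t) \<bullet> w\<bar>"
proof -
  let ?a = "incr x t \<bullet> w" and ?b = "incr x t \<bullet> v"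
  have e: "\<bar>\<epsilon>\<bar> * norm (force_incr x t) \<le> \<bar>?a\<bar> / 10"
    using eps_force_incr[of x t] norm_le[of "incr x t"] assms by simp
  have ew: "\<bar>\<epsilon> * (force_incr x t \<bullet> w)\<bar> \<le> \<bar>?a\<bar> / 10"
    using e mult_left_mono[OF inner_w_le[of "force_incr x t"], of "\<bar>\<epsilon>\<bar>"] by (simp add: abs_mult)
  have ev: "\<bar>\<epsilon> * (force_incr x t \<bullet> v)\<bar> \<le> \<bar>?a\<bar> / 10"
    using e mult_left_mono[OF inner_v_le[of "force_incr x t"], of "\<bar>\<epsilon>\<bar>"] by (simp add: abs_mult)
  have m: "8/5 * \<bar>?a\<bar> \<le> \<bar>\<mu> * ?a\<bar>"
    using mult_right_mono[OF mu, of "\<bar>?a\<bar>"] mu by (simp add: abs_mult)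
  have l: "\<bar>\<kappa> * ?b\<bar> \<le> 31/50 * \<bar>?a\<bar>"
    using mult_mono[OF lambda(2), of "\<bar>?b\<bar>" "\<bar>?a\<bar>"] assms by (simp add: abs_mult)
  show A: "3/2 * \<bar>?a\<bar> \<le> \<bar>incr (S x) (\<kappa> * t) \<bullet> w\<bar>"
    unfolding incr_step_w using m ew by linarith
  show "\<bar>incr (S x) (\<kappa> * t) \<bullet> v\<bar> < \<bar>incr (S x) (\<kappa> * t) \<bullet> w\<bar>"
    using A l ev assms unfolding incr_step_v by linarith
qed

lemma lambda_mult_le: "\<bar>\<kappa> * t\<bar> \<le> \<bar>t\<bar>"
  using mult_right_mono[OF lambda(2), of "\<bar>t\<bar>"] by (simp add: abs_mult)

lemma cone_growth:
  assumes "\<bar>incr x t \<bullet> v\<bar> < \<bar>incr x t \<bullet> w\<bar>"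
  shows "(3/2) ^ n * \<bar>incr x t \<bullet> w\<bar> \<le> \<bar>t\<bar> + 2 * B"
  using assms
proof (induction n arbitrary: x t)
  case 0
  then show ?case using inner_w_le[of "incr x t"] norm_incr_le[of x t] by simp
next
  case (Suc n)
  have "(3/2) ^ Suc n * \<bar>incr x t \<bullet> w\<bar> = (3/2) ^ n * (3/2 * \<bar>incr x t \<bullet> w\<bar>)" by simp
  also have "\<dots> \<le> (3/2) ^ n * \<bar>incr (S x) (\<kappa> * t) \<bullet> w\<bar>"
    using cone_step(2)[OF Suc.prems] by (intro mult_left_mono) auto
  also have "\<dots> \<le> \<bar>\<kappa> * t\<bar> + 2 * B" by (rule Suc.IH[OF cone_step(1)[OF Suc.prems]])
  also have "\<dots> \<le> \<bar>t\<bar> + 2 * B" using lambda_mult_le by simp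
  finally show ?case .
qed

text \<open>An increment in the unstable cone would grow like \<open>(3/2) ^ n\<close>, against a
  bound that is independent of \<open>n\<close>.\<close>

lemma incr_in_stable_cone: "\<bar>incr x t \<bullet> w\<bar> \<le> \<bar>incr x t \<bullet> v\<bar>"
proof (rule ccontr)
  let ?a = "\<bar>incr x t \<bullet> w\<bar>"
  assume "\<not> ?thesis"
  then have c: "\<bar>incr x t \<bullet> v\<bar> < ?a" by simp
  then have pos: "0 < ?a" by linarith
  obtain n where "(\<bar>t\<bar> + 2 * B) / ?a < (3/2) ^ n"
    using real_arch_pow[of "3/2"] by auto
  then have "\<bar>t\<bar> + 2 * B < (3/2) ^ n * ?a" using pos by (simp add: pos_divide_less_eq)
  with cone_growth[OF c, of n] show False by simp
qed

text \<open>A zero \<open>v\<close>-component forces a zero \<open>w\<close>-component by the cone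
  bound, and then two distinct nearby points would have the same image under
  \<open>G\<close>.\<close>

lemma incr_v_nonzero:
  assumes "0 < \<bar>t\<bar>" "\<bar>t\<bar> < \<rho>" shows "incr x t \<bullet> v \<noteq> 0"
proof
  assume "incr x t \<bullet> v = 0"
  with incr_in_stable_cone[of x t] norm_le[of "incr x t"] have "incr x t = 0" by simp
  with G_inj[OF assms, of x] show False by (simp add: incr_def)
qed

text \<open>Division by zero yields 0, so the cone bound gives this for every
  \<open>t\<close>.\<close>

lemma slope_bound: "\<bar>slope x t\<bar> \<le> 1"
  using incr_in_stable_cone[of x t] by (simp add: slope_def divide_le_eq_1)

section \<open>Contraction of slopes and convergence\<close>

text \<open>Both component equations are divided by the \<open>v\<close>-component at
  \<open>x\<close>. Expressing the slope at \<open>x\<close> through the slope at \<open>S x\<close>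
  puts the expanding factor \<open>\<mu>\<close> on the left, so going backwards along the orbit
  contracts.\<close>

lemma slope_step:
  fixes x t
  assumes "0 < \<bar>t\<bar>" "\<bar>t\<bar> < \<rho>"
  defines "q \<equiv> force_incr x t /\<^sub>R (incr x t \<bullet> v)"
  shows "\<mu> * slope x t = slope (S x) (\<kappa> * t) * (\<kappa> - \<epsilon> * (q \<bullet> v)) + \<epsilon> * (q \<bullet> w)"
proof -
  have "0 < \<bar>\<kappa> * t\<bar>" "\<bar>\<kappa> * t\<bar> < \<rho>"
    using assms lambda lambda_mult_le[of t] by auto
  then have "incr (S x) (\<kappa> * t) \<bullet> v \<noteq> 0" by (rule incr_v_nonzero)
  then have "slope (S x) (\<kappa> * t) * (incr (S x) (\<kappa> * t) \<bullet> v) = incr (S x) (\<kappa> * t) \<bullet> w"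
    by (simp add: slope_def)
  then have *: "slope (S x) (\<kappa> * t) * (\<kappa> * (incr x t \<bullet> v) - \<epsilon> * (force_incr x t \<bullet> v)) =
      \<mu> * (incr x t \<bullet> w) - \<epsilon> * (force_incr x t \<bullet> w)"
    by (simp add: incr_step_v incr_step_w)
  have b: "incr x t \<bullet> v \<noteq> 0" using assms(1,2) by (rule incr_v_nonzero)
  let ?s = "slope (S x) (\<kappa> * t)"
  have "?s * (\<kappa> - \<epsilon> * (q \<bullet> v)) + \<epsilon> * (q \<bullet> w) =
    (?s * (\<kappa> * (incr x t \<bullet> v) - \<epsilon> * (force_incr x t \<bullet> v)) + \<epsilon> * (force_incr x t \<bullet> w)) / (incr x t \<bullet> v)"
    using b by (simp add: q_def field_simps)
  also have "\<dots> = \<mu> * slope x t" unfolding * by (simp add: slope_def)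
  finally show ?thesis by simp
qed

lemma incr_tendsto: "(incr x \<longlongrightarrow> 0) (at 0)"
proof -
  have "((\<lambda>t. x + t *\<^sub>R v) \<longlongrightarrow> x + 0 *\<^sub>R v) (at 0)"
    by (intro tendsto_intros)
  then have "((\<lambda>t. G (x + t *\<^sub>R v)) \<longlongrightarrow> G x) (at 0)"
    using isCont_tendsto_compose[OF G_cont] by simp
  then show ?thesis
    unfolding incr_def using LIM_zero by blast
qed

text \<open>Differentiability of \<open>F\<close> at \<open>G x\<close> combines with increments
  that tend to 0. The radius may depend on \<open>x\<close>: only finitely many orbit points are
  used for each accuracy.\<close>

lemma force_incr_linearised:
  assumes "0 < \<eta>"
  obtains d where "0 < d"
    "\<And>t. \<bar>t\<bar> < d \<Longrightarrow> norm (force_incr x t - F' (G x) (incr x t)) \<le> \<eta> * norm (incr x t)"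
proof -
  obtain r where r: "0 < r"
    "\<And>y. norm (y - G x) < r \<Longrightarrow> norm (F y - F (G x) - F' (G x) (y - G x)) \<le> \<eta> * norm (y - G x)"
    using deriv_F[of "G x"] assms unfolding has_derivative_at_alt by blast
  obtain d where d: "0 < d" "\<And>t. t \<noteq> 0 \<Longrightarrow> \<bar>t\<bar> < d \<Longrightarrow> norm (incr x t) < r"
    using incr_tendsto[of x] r(1) unfolding LIM_eq by auto
  have "norm (force_incr x t - F' (G x) (incr x t)) \<le> \<eta> * norm (incr x t)" if "\<bar>t\<bar> < d" for t
  proof -
    have "norm (incr x t) < r" using d(2)[of t] that r(1) by (cases "t = 0") (auto simp: incr_def)
    then show ?thesis using r(2)[of "G x + incr x t"] by (simp add: force_incr_def)
  qed
  with d(1) show ?thesis using that by blast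
qed

text \<open>Up to the error \<open>R\<close>, \<open>q t\<close> is affine in the slope, with
  coefficients \<open>?A w\<close> and \<open>?A v\<close> independent of \<open>t\<close>. Hence
  \<open>q t - q u\<close> is controlled by the difference of slopes, with a small factor that the
  left side absorbs.\<close>

lemma slope_contraction:
  assumes \<eta>: "0 < \<eta>"
  obtains d where "0 < d" "d \<le> \<rho>"
    "\<And>t u. 0 < \<bar>t\<bar> \<Longrightarrow> \<bar>t\<bar> < d \<Longrightarrow> 0 < \<bar>u\<bar> \<Longrightarrow> \<bar>u\<bar> < d \<Longrightarrow>
       \<bar>slope x t - slope x u\<bar> \<le> 1/2 * \<bar>slope (S x) (\<kappa> * t) - slope (S x) (\<kappa> * u)\<bar> + \<eta>"
proof -
  \<comment> \<open>Each of \<open>R t\<close> and \<open>R u\<close> will be at most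
    \<open>2 * \<theta>\<close>, so together they contribute at most \<open>\<eta> / 2\<close> after
    multiplication by \<open>\<bar>\<epsilon>\<bar>\<close>; the \<open>+ 1\<close> covers
    \<open>\<epsilon> = 0\<close>.\<close>
  define \<theta> where "\<theta> = \<eta> / (8 * (\<bar>\<epsilon>\<bar> + 1))"
  have \<theta>: "0 < \<theta>" using \<eta> by (simp add: \<theta>_def)
  have \<theta>': "8 * \<bar>\<epsilon>\<bar> * \<theta> \<le> \<eta>" using \<eta> by (simp add: \<theta>_def field_simps)
  obtain d where d: "0 < d"
    "\<And>t. \<bar>t\<bar> < d \<Longrightarrow> norm (force_incr x t - F' (G x) (incr x t)) \<le> \<theta> * norm (incr x t)"
    using force_incr_linearised[OF \<theta>] by blast
  let ?A = "F' (G x)"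
  have linA: "linear ?A" using has_derivative_linear[OF deriv_F] .
  define q where "q t = force_incr x t /\<^sub>R (incr x t \<bullet> v)" for t
  define R where "R t = q t - (slope x t *\<^sub>R ?A w + ?A v)" for t
  have ratio: "norm (incr x t) \<le> 2 * \<bar>incr x t \<bullet> v\<bar>" for t
    using norm_le[of "incr x t"] incr_in_stable_cone[of x t] by simp
  have qb: "\<bar>\<epsilon>\<bar> * norm (q t) \<le> 1/10" if "0 < \<bar>t\<bar>" "\<bar>t\<bar> < \<rho>" for t
  proof -
    have "0 < \<bar>incr x t \<bullet> v\<bar>" using incr_v_nonzero[OF that] by simp
    moreover have "\<bar>\<epsilon>\<bar> * norm (force_incr x t) \<le> \<bar>incr x t \<bullet> v\<bar> / 10"
      using eps_force_incr[of x t] ratio[of t] by simp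
    ultimately show ?thesis by (simp add: q_def field_simps)
  qed
  have Rb: "norm (R t) \<le> 2 * \<theta>" if "0 < \<bar>t\<bar>" "\<bar>t\<bar> < \<rho>" "\<bar>t\<bar> < d" for t
  proof -
    let ?b = "incr x t \<bullet> v"
    have b: "?b \<noteq> 0" using incr_v_nonzero that by blast
    have "?A (incr x t) = ?A ((incr x t \<bullet> w) *\<^sub>R w + ?b *\<^sub>R v)" using expand[of "incr x t"] by simp
    also have "\<dots> = (incr x t \<bullet> w) *\<^sub>R ?A w + ?b *\<^sub>R ?A v"
      by (simp add: linear_add[OF linA] linear_scale[OF linA])
    finally have "R t = (force_incr x t - ?A (incr x t)) /\<^sub>R ?b"
      using b by (simp add: R_def q_def slope_def algebra_simps divide_inverse)
    then have "norm (R t) = norm (force_incr x t - ?A (incr x t)) / \<bar>?b\<bar>"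
      by (simp add: divide_inverse mult.commute)
    also have "\<dots> \<le> (\<theta> * (2 * \<bar>?b\<bar>)) / \<bar>?b\<bar>"
      using d(2)[OF that(3)] mult_left_mono[OF ratio[of t], of \<theta>] \<theta>
      by (intro divide_right_mono) linarith+
    finally show ?thesis using b by simp
  qed
  have main: "\<bar>slope x t - slope x u\<bar> \<le> 1/2 * \<bar>slope (S x) (\<kappa> * t) - slope (S x) (\<kappa> * u)\<bar> + \<eta>"
    if t: "0 < \<bar>t\<bar>" "\<bar>t\<bar> < min d \<rho>" and u: "0 < \<bar>u\<bar>" "\<bar>u\<bar> < min d \<rho>" for t u
  proof -
    let ?s = "slope x t" and ?s' = "slope x u"
    let ?r = "slope (S x) (\<kappa> * t)" and ?r' = "slope (S x) (\<kappa> * u)"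
    have "q t - q u = (?s - ?s') *\<^sub>R ?A w + (R t - R u)"
      by (simp add: R_def algebra_simps)
    then have "norm (q t - q u) \<le> norm ((?s - ?s') *\<^sub>R ?A w) + norm (R t - R u)"
      by (metis norm_triangle_ineq)
    also have "\<dots> \<le> \<bar>?s - ?s'\<bar> * L + (norm (R t) + norm (R u))"
      using deriv_F_bound[of "G x" w] norm_w
      by (intro add_mono norm_triangle_ineq4) (auto intro!: mult_left_mono)
    also have "\<dots> \<le> \<bar>?s - ?s'\<bar> * L + 4 * \<theta>"
      using Rb[of t] Rb[of u] t u by simp
    finally have "\<bar>\<epsilon>\<bar> * norm (q t - q u) \<le> \<bar>\<epsilon>\<bar> * (\<bar>?s - ?s'\<bar> * L + 4 * \<theta>)"
      by (rule mult_left_mono) simp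
    also have "\<dots> = (\<bar>\<epsilon>\<bar> * L) * \<bar>?s - ?s'\<bar> + 4 * \<bar>\<epsilon>\<bar> * \<theta>" by (simp add: algebra_simps)
    also have "\<dots> \<le> 1/20 * \<bar>?s - ?s'\<bar> + \<eta> / 2"
      using \<theta>' small by (intro add_mono mult_right_mono) auto
    finally have e: "\<bar>\<epsilon>\<bar> * norm (q t - q u) \<le> 1/20 * \<bar>?s - ?s'\<bar> + \<eta> / 2" .
    have ew: "\<bar>\<epsilon> * ((q t - q u) \<bullet> w)\<bar> \<le> 1/20 * \<bar>?s - ?s'\<bar> + \<eta> / 2"
      using e mult_left_mono[OF inner_w_le[of "q t - q u"], of "\<bar>\<epsilon>\<bar>"] by (simp add: abs_mult)
    have "\<bar>\<epsilon> * ((q t - q u) \<bullet> v)\<bar> \<le> 1/20 * \<bar>?s - ?s'\<bar> + \<eta> / 2"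
      using e mult_left_mono[OF inner_v_le[of "q t - q u"], of "\<bar>\<epsilon>\<bar>"] by (simp add: abs_mult)
    then have ev: "\<bar>?r' * (\<epsilon> * ((q t - q u) \<bullet> v))\<bar> \<le> 1/20 * \<bar>?s - ?s'\<bar> + \<eta> / 2"
      using mult_mono[OF slope_bound[of "S x" "\<kappa> * u"], of "\<bar>\<epsilon> * ((q t - q u) \<bullet> v)\<bar>"
        "1/20 * \<bar>?s - ?s'\<bar> + \<eta> / 2"] by (simp add: abs_mult)
    have "\<bar>\<epsilon> * (q t \<bullet> v)\<bar> \<le> 1/10"
      using qb[of t] t mult_left_mono[OF inner_v_le[of "q t"], of "\<bar>\<epsilon>\<bar>"] by (simp add: abs_mult)
    \<comment> \<open>The constant is \<open>31/50 + 1/10\<close>.\<close>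
    then have "\<bar>\<kappa> - \<epsilon> * (q t \<bullet> v)\<bar> \<le> 18/25" using lambda(2) by linarith
    then have er: "\<bar>(?r - ?r') * (\<kappa> - \<epsilon> * (q t \<bullet> v))\<bar> \<le> 18/25 * \<bar>?r - ?r'\<bar>"
      using mult_left_mono[of "\<bar>\<kappa> - \<epsilon> * (q t \<bullet> v)\<bar>" "18/25" "\<bar>?r - ?r'\<bar>"] by (simp add: abs_mult)
    \<comment> \<open>Two instances of \<open>slope_step\<close> are subtracted, with the difference
      of products split as \<open>(?r - ?r')\<close> times the first factor plus \<open>?r'\<close>
      times the difference of factors.\<close>
    have "\<mu> * (?s - ?s') = (?r - ?r') * (\<kappa> - \<epsilon> * (q t \<bullet> v))
        - ?r' * (\<epsilon> * ((q t - q u) \<bullet> v)) + \<epsilon> * ((q t - q u) \<bullet> w)"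
      using slope_step[of t x] slope_step[of u x] t u
      by (simp add: q_def[symmetric] inner_diff_left algebra_simps)
    then have "\<bar>\<mu> * (?s - ?s')\<bar> \<le> 18/25 * \<bar>?r - ?r'\<bar> + 1/10 * \<bar>?s - ?s'\<bar> + \<eta>"
      using er ev ew by linarith
    moreover have "8/5 * \<bar>?s - ?s'\<bar> \<le> \<bar>\<mu> * (?s - ?s')\<bar>"
      using mult_right_mono[OF mu, of "\<bar>?s - ?s'\<bar>"] mu by (simp add: abs_mult)
    \<comment> \<open>Absorbing \<open>1/10 * X\<close> leaves \<open>3/2 * X\<close> on the left,
      and \<open>18/25\<close> divided by \<open>3/2\<close> is \<open>12/25\<close>.\<close>
    moreover have "X \<le> 1/2 * Y + \<eta>" if "Z \<le> 18/25 * Y + 1/10 * X + \<eta>" "8/5 * X \<le> Z" "0 \<le> Y" for X Y Z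
      using that \<eta> by linarith
    ultimately show ?thesis by (metis abs_ge_zero)
  qed
  show ?thesis using that[of "min d \<rho>"] main d(1) rho by auto
qed

text \<open>Each step along the orbit halves the oscillation, starting from the bound 2 that
  \<open>slope_bound\<close> gives. The radius \<open>d\<close> depends on both \<open>n\<close> and
  \<open>x\<close>.\<close>

lemma slope_oscillation:
  assumes "0 < \<eta>"
  shows "\<exists>d>0. \<forall>t u. 0 < \<bar>t\<bar> \<and> \<bar>t\<bar> < d \<and> 0 < \<bar>u\<bar> \<and> \<bar>u\<bar> < d \<longrightarrow>
    \<bar>slope x t - slope x u\<bar> \<le> 2 * (1/2) ^ n + \<eta>"
  using assms
proof (induction n arbitrary: x \<eta>)
  case 0
  have "\<bar>slope x t - slope x u\<bar> \<le> 2 * (1/2) ^ 0 + \<eta>" for t u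
    using slope_bound[of x t] slope_bound[of x u] 0 by simp
  then show ?case using zero_less_one by blast
next
  case (Suc n)
  then have \<eta>2: "0 < \<eta> / 2" by simp
  obtain d1 where d1: "0 < d1"
    "\<And>t u. 0 < \<bar>t\<bar> \<Longrightarrow> \<bar>t\<bar> < d1 \<Longrightarrow> 0 < \<bar>u\<bar> \<Longrightarrow> \<bar>u\<bar> < d1 \<Longrightarrow>
       \<bar>slope x t - slope x u\<bar> \<le> 1/2 * \<bar>slope (S x) (\<kappa> * t) - slope (S x) (\<kappa> * u)\<bar> + \<eta> / 2"
    using slope_contraction[OF \<eta>2] by metis
  obtain d2 where d2: "0 < d2" "\<forall>t u. 0 < \<bar>t\<bar> \<and> \<bar>t\<bar> < d2 \<and> 0 < \<bar>u\<bar> \<and> \<bar>u\<bar> < d2 \<longrightarrow>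
    \<bar>slope (S x) t - slope (S x) u\<bar> \<le> 2 * (1/2) ^ n + \<eta> / 2"
    using Suc.IH[OF \<eta>2] by blast
  have "\<bar>slope x t - slope x u\<bar> \<le> 2 * (1/2) ^ Suc n + \<eta>"
    if t: "0 < \<bar>t\<bar>" "\<bar>t\<bar> < min d1 d2" and u: "0 < \<bar>u\<bar>" "\<bar>u\<bar> < min d1 d2" for t u
  proof -
    \<comment> \<open>The parameters \<open>\<kappa> * t\<close> and \<open>\<kappa> * u\<close> are
      nonzero and no larger than \<open>t\<close> and \<open>u\<close>, so they stay in range.
      Halving leaves \<open>\<eta> / 4\<close>, to which the contraction adds
      \<open>\<eta> / 2\<close>.\<close>
    have "\<bar>slope (S x) (\<kappa> * t) - slope (S x) (\<kappa> * u)\<bar> \<le> 2 * (1/2) ^ n + \<eta> / 2"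
      using d2(2) t u lambda lambda_mult_le[of t] lambda_mult_le[of u] by simp
    with d1(2)[of t u] t u Suc.prems show ?thesis by simp
  qed
  then show ?case using d1(1) d2(1) by (intro exI[of _ "min d1 d2"]) auto
qed

lemma slope_convergent: "\<exists>l. (slope x \<longlongrightarrow> l) (at 0)"
proof -
  have *: "\<exists>d>0. \<forall>t u. 0 < \<bar>t\<bar> \<and> \<bar>t\<bar> < d \<and> 0 < \<bar>u\<bar> \<and> \<bar>u\<bar> < d \<longrightarrow>
      \<bar>slope x t - slope x u\<bar> < e" if "0 < e" for e
  proof -
    have e4: "0 < e / 4" using that by simp
    \<comment> \<open>The depth \<open>n\<close> is fixed first, and only then the radius that
      depends on it.\<close>
    then have "\<exists>n. (1/2::real) ^ n < e / 4" by (intro real_arch_pow_inv) auto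
    then obtain n where "(1/2::real) ^ n < e / 4" by blast
    then have n: "2 * (1/2) ^ n + e / 4 < e" using that by simp
    obtain d where d: "0 < d" "\<forall>t u. 0 < \<bar>t\<bar> \<and> \<bar>t\<bar> < d \<and> 0 < \<bar>u\<bar> \<and> \<bar>u\<bar> < d \<longrightarrow>
        \<bar>slope x t - slope x u\<bar> \<le> 2 * (1/2) ^ n + e / 4"
      using slope_oscillation[OF e4, of x n] by (elim exE conjE) (rule that)
    show ?thesis
    proof (intro exI[of _ d] conjI allI impI)
      fix t u assume "0 < \<bar>t\<bar> \<and> \<bar>t\<bar> < d \<and> 0 < \<bar>u\<bar> \<and> \<bar>u\<bar> < d"
      then have "\<bar>slope x t - slope x u\<bar> \<le> 2 * (1/2) ^ n + e / 4" using d(2) by blast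
      with n show "\<bar>slope x t - slope x u\<bar> < e" by simp
    qed (rule d(1))
  qed
  have "cauchy_filter (filtermap (slope x) (at 0))"
    unfolding cauchy_filter_metric_filtermap dist_real_def
  proof (intro allI impI)
    fix e :: real assume "0 < e"
    then obtain d where "0 < d" "\<forall>t u. 0 < \<bar>t\<bar> \<and> \<bar>t\<bar> < d \<and> 0 < \<bar>u\<bar> \<and> \<bar>u\<bar> < d \<longrightarrow>
        \<bar>slope x t - slope x u\<bar> < e"
      using * by blast
    then show "\<exists>P. eventually P (at 0) \<and> (\<forall>t u. P t \<and> P u \<longrightarrow> \<bar>slope x t - slope x u\<bar> < e)"
      by (intro exI[of _ "\<lambda>t. 0 < \<bar>t\<bar> \<and> \<bar>t\<bar> < d"]) (auto simp: eventually_at)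
  qed
  moreover have "complete (UNIV :: real set)" by (rule complete_UNIV)
  ultimately show ?thesis
    using cauchy_filter_complete_converges[of "filtermap (slope x) (at 0)" UNIV]
    by (auto simp: filterlim_def filtermap_bot_iff)
qed

end

section \<open>Lifting the conjugacy to the plane\<close>

lemma torus_dist_lift:
  assumes "dist p q < e"
  obtains z where "torus_proj z = p - q" "norm z < e"
proof -
  obtain x y where "torus_proj x = p" "torus_proj y = q" "dist x y < e"
    using assms by (rule dist_torus2_less)
  then show ?thesis using that[of "x - y"] by (simp add: torus_proj_diff dist_norm)
qed

lemma cat_map_torus_proj: "cat_map (torus_proj x) = torus_proj (S0 *v x)"
  by (rule cat_map.abs_eq)

text \<open>Every point has a representative in a closed square of side \<open>2 * pi\<close>; a
  finite net of this compact set projects to the torus without increasing distances.\<close>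

lemma totally_bounded_torus:
  assumes "0 < e"
  shows "\<exists>A::torus2 set. finite A \<and> (\<forall>p. \<exists>q\<in>A. dist p q < e)"
proof -
  have "compact (cbox 0 (\<chi> i. 2 * pi) :: (real^2) set)" by (rule compact_cbox)
  then obtain k :: "(real^2) set" where k: "finite k" "cbox 0 (\<chi> i. 2 * pi) \<subseteq> (\<Union>x\<in>k. ball x e)"
    using assms unfolding compact_eq_totally_bounded by blast
  have "\<exists>q\<in>torus_proj ` k. dist p q < e" for p
  proof -
    obtain x where x: "p = torus_proj x" using torus_proj_surj by blast
    define y :: "real^2" where "y = (\<chi> i. x $ i - 2 * pi * of_int \<lfloor>x $ i / (2 * pi)\<rfloor>)"
    have py: "torus_proj x = torus_proj y"
      unfolding torus_proj_eq_iff y_def by auto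
    have "0 \<le> y $ i \<and> y $ i \<le> 2 * pi" for i
    proof -
      have "of_int \<lfloor>x $ i / (2 * pi)\<rfloor> * (2 * pi) \<le> x $ i"
        by (subst pos_le_divide_eq[symmetric]) (simp, rule of_int_floor_le)
      moreover have "x $ i \<le> (of_int \<lfloor>x $ i / (2 * pi)\<rfloor> + 1) * (2 * pi)"
        by (subst pos_divide_le_eq[symmetric]) (simp, rule real_of_int_floor_add_one_ge)
      ultimately show ?thesis by (simp add: y_def algebra_simps)
    qed
    then have "y \<in> cbox 0 (\<chi> i. 2 * pi)" by (simp add: mem_box_cart)
    then obtain z where z: "z \<in> k" "dist z y < e" using k(2) by auto
    then have "dist p (torus_proj z) < e"
      using dist_torus2_le[of y z] x py by (simp add: dist_commute)
    then show ?thesis using z(1) by blast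
  qed
  then show ?thesis using k(1) by (intro exI[of _ "torus_proj ` k"]) auto
qed

text \<open>The deck group \<open>2 \<pi> \<int>\<^sup>2\<close> is discrete, so a path that starts at \<open>0\<close> cannot jump to another sheet.\<close>

lemma torus_path_lift_small:
  fixes g :: "'a::topological_space \<Rightarrow> real^2"
  assumes "connected T" "continuous_on T g" "a \<in> T" "g a = 0" "b \<in> T"
    and \<delta>: "0 < \<delta>" "\<delta> \<le> 1"
    and near: "\<And>s. s \<in> T \<Longrightarrow> dist (torus_proj (g s)) 0 < \<delta>"
  shows "norm (g b) < \<delta>"
proof (rule ccontr)
  assume "\<not> ?thesis"
  then have ge: "\<delta> \<le> norm (g b)" by simp
  have "connected ((\<lambda>s. norm (g s)) ` T)"
    using assms(1,2) by (intro connected_continuous_image continuous_intros)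
  moreover have "0 \<in> (\<lambda>s. norm (g s)) ` T" using assms(3,4) by force
  moreover have "norm (g b) \<in> (\<lambda>s. norm (g s)) ` T" using assms(5) by simp
  ultimately have "{0..norm (g b)} \<subseteq> (\<lambda>s. norm (g s)) ` T"
    by (rule connected_contains_Icc)
  \<comment> \<open>Where the norm equals \<open>\<delta>\<close>, the torus point still has a
    representative of norm below \<open>\<delta>\<close>. The two are less than
    \<open>2 * pi\<close> apart, hence equal, which is absurd.\<close>
  then have "\<delta> \<in> (\<lambda>s. norm (g s)) ` T" using ge \<delta> by auto
  then obtain s where s: "s \<in> T" "norm (g s) = \<delta>" by auto
  obtain z where z: "torus_proj z = torus_proj (g s)" "norm z < \<delta>"
    using torus_dist_lift[OF near[OF s(1)]] by auto
  have "norm (z - g s) \<le> norm z + norm (g s)" by (rule norm_triangle_ineq4)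
  also have "\<dots> < 2 * pi" using z(2) s(2) \<delta> pi_gt3 by simp
  finally have "z = g s" using z(1) by (intro torus_proj_small_unique)
  then show False using z(2) s(2) by simp
qed

text \<open>Taking real parts turns the sum into sines and cosines, whose derivatives are bounded by
  coefficients and frequencies. The factor 2 in \<open>L\<close> accounts for one sine and one
  cosine term per frequency.\<close>

lemma trig_polynomial_bounded_derivative:
  assumes "trig_polynomial f"
  obtains F' :: "real^2 \<Rightarrow> real^2 \<Rightarrow> real^2" and L :: real where
    "\<And>x. ((\<lambda>x. f (torus_proj x)) has_derivative F' x) (at x)"
    "\<And>x z. norm (F' x z) \<le> L * norm z"
proof -
  obtain N :: real and c :: "int^2 \<Rightarrow> complex^2" where fc: "\<And>x j.
        complex_of_real (f (torus_proj x) $ j) =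
          (\<Sum>n | norm (of_int_vec n) < N. c n $ j * exp (\<i> * complex_of_real (of_int_vec n \<bullet> x)))"
    using assms unfolding trig_polynomial_def by blast
  let ?I = "{n. norm (of_int_vec n) < N}"
  have f_real: "f (torus_proj x) $ j = (\<Sum>n\<in>?I. Re (c n $ j) * cos (of_int_vec n \<bullet> x)
      - Im (c n $ j) * sin (of_int_vec n \<bullet> x))" for x j
  proof -
    have "f (torus_proj x) $ j = Re (complex_of_real (f (torus_proj x) $ j))" by simp
    also have "\<dots> = (\<Sum>n\<in>?I. Re (c n $ j * exp (\<i> * complex_of_real (of_int_vec n \<bullet> x))))"
      unfolding fc by (rule Re_sum)
    finally show ?thesis by (simp add: Re_exp Im_exp)
  qed
  define F' :: "real^2 \<Rightarrow> real^2 \<Rightarrow> real^2" where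
    "F' x z = (\<chi> j. \<Sum>n\<in>?I. - Re (c n $ j) * (sin (of_int_vec n \<bullet> x) * (of_int_vec n \<bullet> z))
      - Im (c n $ j) * (cos (of_int_vec n \<bullet> x) * (of_int_vec n \<bullet> z)))" for x z
  define L where "L = (\<Sum>j\<in>UNIV. \<Sum>n\<in>?I. 2 * cmod (c n $ j) * norm (of_int_vec n))"
  have comp: "((\<lambda>x. f (torus_proj x) $ j) has_derivative (\<lambda>z. F' x z $ j)) (at x)" for x j
    unfolding f_real F'_def vec_lambda_beta
    by (auto intro!: derivative_eq_intros sum.cong ext simp: algebra_simps)
  have "((\<lambda>x. f (torus_proj x)) has_derivative F' x) (at x)" for x
    using comp unfolding has_derivative_componentwise_within[of "\<lambda>x. f (torus_proj x)"]
    by (auto simp: Basis_vec_def inner_axis)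
  moreover have "norm (F' x z) \<le> L * norm z" for x z
  proof -
    have summand_bound: "\<bar>- Re a * (sin \<theta> * (n \<bullet> z)) - Im a * (cos \<theta> * (n \<bullet> z))\<bar> \<le> 2 * cmod a * norm n * norm z"
      for a \<theta> and n :: "real^2"
    proof -
      have "\<bar>- Re a * (sin \<theta> * (n \<bullet> z)) - Im a * (cos \<theta> * (n \<bullet> z))\<bar>
        \<le> \<bar>Re a\<bar> * (\<bar>sin \<theta>\<bar> * \<bar>n \<bullet> z\<bar>) + \<bar>Im a\<bar> * (\<bar>cos \<theta>\<bar> * \<bar>n \<bullet> z\<bar>)"
        by (simp add: abs_mult[symmetric])
      also have "\<dots> \<le> cmod a * (1 * (norm n * norm z)) + cmod a * (1 * (norm n * norm z))"
        by (intro add_mono mult_mono abs_Re_le_cmod abs_Im_le_cmod abs_sin_le_one abs_cos_le_one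
            Cauchy_Schwarz_ineq2) auto
      finally show ?thesis by simp
    qed
    have "norm (F' x z) \<le> (\<Sum>j\<in>UNIV. \<bar>F' x z $ j\<bar>)" by (rule norm_le_l1_cart)
    also have "\<dots> \<le> (\<Sum>j\<in>UNIV. \<Sum>n\<in>?I. 2 * cmod (c n $ j) * norm (of_int_vec n) * norm z)"
      unfolding F'_def vec_lambda_beta
      by (intro sum_mono order_trans[OF sum_abs] summand_bound)
    also have "\<dots> = L * norm z" by (simp add: L_def sum_distrib_right)
    finally show ?thesis .
  qed
  ultimately show ?thesis using that by blast
qed

section \<open>The lift selected by the expansion\<close>

locale torus_conjugacy_family =
  fixes f :: "torus2 \<Rightarrow> real^2" and H :: "real \<Rightarrow> torus2 \<Rightarrow> torus2"
    and h :: "nat \<Rightarrow> torus2 \<Rightarrow> real^2" and C \<beta> r :: real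
  assumes f_cont: "continuous_on UNIV (\<lambda>x. f (torus_proj x))"
    and \<beta>: "0 < \<beta>" and r: "0 < r"
    and H_bij: "\<And>\<epsilon>. \<bar>\<epsilon>\<bar> < r \<Longrightarrow> bij (H \<epsilon>)"
    and H_conj: "\<And>\<epsilon>. \<bar>\<epsilon>\<bar> < r \<Longrightarrow> H \<epsilon> \<circ> cat_map \<circ> inv (H \<epsilon>) = perturbed_cat_map f \<epsilon>"
    and H_hoelder: "\<And>\<epsilon> p q. \<bar>\<epsilon>\<bar> < r \<Longrightarrow> dist (H \<epsilon> p) (H \<epsilon> q) \<le> C * dist p q powr \<beta>"
    and summable_h: "\<And>\<epsilon> p. \<bar>\<epsilon>\<bar> < r \<Longrightarrow> summable (\<lambda>k. \<epsilon> ^ Suc k *\<^sub>R h (Suc k) p)"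
    and H_expansion: "\<And>\<epsilon> p. \<bar>\<epsilon>\<bar> < r \<Longrightarrow>
      H \<epsilon> p = p + torus_proj (\<Sum>k. \<epsilon> ^ Suc k *\<^sub>R h (Suc k) p)"
begin

text \<open>The expansion picks one lift of \<open>H \<epsilon> p - p\<close> among its lattice
  translates. It is continuous in \<open>\<epsilon>\<close> by construction; continuity in
  \<open>p\<close> has to be recovered from the Hoelder bound.\<close>

definition disp :: "real \<Rightarrow> torus2 \<Rightarrow> real^2" where
  "disp \<epsilon> p = (\<Sum>k. \<epsilon> ^ Suc k *\<^sub>R h (Suc k) p)"

definition lift_H :: "real \<Rightarrow> real^2 \<Rightarrow> real^2" where
  "lift_H \<epsilon> x = x + disp \<epsilon> (torus_proj x)"

lemma H_disp: "\<bar>\<epsilon>\<bar> < r \<Longrightarrow> H \<epsilon> p = p + torus_proj (disp \<epsilon> p)"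
  using H_expansion by (simp add: disp_def)

lemma torus_proj_lift_H: "\<bar>\<epsilon>\<bar> < r \<Longrightarrow> torus_proj (lift_H \<epsilon> x) = H \<epsilon> (torus_proj x)"
  by (simp add: lift_H_def torus_proj_add H_disp)

lemma disp_zero: "disp 0 p = 0"
  by (simp add: disp_def)

lemma disp_continuous: "continuous_on {-r<..<r} (\<lambda>\<epsilon>. disp \<epsilon> p)"
proof -
  have "continuous_on {-r<..<r} (\<lambda>\<epsilon>. disp \<epsilon> p $ i)" for i
  proof -
    \<comment> \<open>Index 0 is padded with 0 to obtain an ordinary power series.\<close>
    define c where "c k = (case k of 0 \<Rightarrow> 0 | Suc l \<Rightarrow> h (Suc l) p $ i)" for k
    have sum_Suc: "summable (\<lambda>k. c (Suc k) * \<epsilon> ^ Suc k)" if "\<bar>\<epsilon>\<bar> < r" for \<epsilon>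
      using bounded_linear.summable[OF bounded_linear_vec_nth[of i] summable_h[OF that, of p]]
      by (simp add: c_def mult.commute)
    have sum_c: "summable (\<lambda>k. c k * \<epsilon> ^ k)" if "\<bar>\<epsilon>\<bar> < r" for \<epsilon>
      using sum_Suc[OF that] summable_Suc_iff[of "\<lambda>k. c k * \<epsilon> ^ k"] by simp
    have eq: "disp \<epsilon> p $ i = (\<Sum>k. c k * \<epsilon> ^ k)" if "\<bar>\<epsilon>\<bar> < r" for \<epsilon>
    proof -
      have "disp \<epsilon> p $ i = (\<Sum>k. (\<epsilon> ^ Suc k *\<^sub>R h (Suc k) p) $ i)"
        unfolding disp_def
        by (rule bounded_linear.suminf[OF bounded_linear_vec_nth summable_h[OF that]])
      also have "\<dots> = (\<Sum>k. c (Suc k) * \<epsilon> ^ Suc k)" by (simp add: c_def mult.commute)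
      also have "\<dots> = (\<Sum>k. c k * \<epsilon> ^ k)"
        using suminf_split_head[OF sum_c[OF that]] by (simp add: c_def)
      finally show ?thesis .
    qed
    have "isCont (\<lambda>\<epsilon>. \<Sum>k. c k * \<epsilon> ^ k) \<epsilon>" if "\<bar>\<epsilon>\<bar> < r" for \<epsilon>
    proof (rule isCont_powser)
      \<comment> \<open>Continuity needs convergence at a point of larger modulus; the midpoint
        between \<open>\<bar>\<epsilon>\<bar>\<close> and \<open>r\<close> serves.\<close>
      show "summable (\<lambda>k. c k * ((\<bar>\<epsilon>\<bar> + r) / 2) ^ k)" using that by (intro sum_c) auto
      show "norm \<epsilon> < norm ((\<bar>\<epsilon>\<bar> + r) / 2)" using that by auto
    qed
    then have "continuous_on {-r<..<r} (\<lambda>\<epsilon>. \<Sum>k. c k * \<epsilon> ^ k)"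
      by (intro continuous_at_imp_continuous_on) auto
    then show ?thesis by (rule continuous_on_eq) (auto simp: eq)
  qed
  then have "continuous_on {-r<..<r} (\<lambda>\<epsilon>. \<chi> i. disp \<epsilon> p $ i)"
    by (intro continuous_on_vec_lambda)
  then show ?thesis by simp
qed

text \<open>On the torus the conjugacy gives this only modulo the lattice. The defect
  \<open>W s\<close> is lattice-valued, continuous in \<open>s\<close> and zero at
  \<open>s = 0\<close>, so it vanishes throughout.\<close>

lemma disp_cat_map:
  assumes "\<bar>\<epsilon>\<bar> < r"
  shows "disp \<epsilon> (cat_map (torus_proj x)) =
    S0 *v disp \<epsilon> (torus_proj x) - \<epsilon> *\<^sub>R f (torus_proj (lift_H \<epsilon> x))"
proof -
  define W where "W s = disp s (cat_map (torus_proj x)) -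
    (S0 *v disp s (torus_proj x) - s *\<^sub>R f (torus_proj (lift_H s x)))" for s
  have W_proj: "torus_proj (W s) = 0" if "\<bar>s\<bar> < r" for s
  proof -
    have "H s (cat_map (torus_proj x)) = perturbed_cat_map f s (H s (torus_proj x))"
      using H_bij[OF that] by (simp add: H_conj[OF that, symmetric] bij_is_inj)
    also have "\<dots> = torus_proj (S0 *v lift_H s x - s *\<^sub>R f (torus_proj (lift_H s x)))"
      by (simp add: perturbed_cat_map_def torus_proj_lift_H[OF that, symmetric]
          cat_map_torus_proj torus_proj_diff)
    finally have "torus_proj (S0 *v lift_H s x - s *\<^sub>R f (torus_proj (lift_H s x))) =
      torus_proj (S0 *v x + disp s (cat_map (torus_proj x)))"
      by (simp add: H_disp[OF that] cat_map_torus_proj torus_proj_add)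
    then have "torus_proj ((S0 *v x + disp s (cat_map (torus_proj x))) -
      (S0 *v lift_H s x - s *\<^sub>R f (torus_proj (lift_H s x)))) = 0"
      by (simp only: torus_proj_diff) simp
    then show ?thesis
      by (simp add: W_def lift_H_def matrix_vector_right_distrib algebra_simps)
  qed
  have f_lift: "continuous_on {-r<..<r} (\<lambda>s. f (torus_proj (lift_H s x)))"
  proof -
    have "continuous_on {-r<..<r} (\<lambda>s. lift_H s x)"
      unfolding lift_H_def by (intro continuous_intros disp_continuous)
    from continuous_on_compose2[OF f_cont this] show ?thesis by simp
  qed
  have cont: "continuous_on {-r<..<r} W"
    unfolding W_def
    by (intro continuous_intros disp_continuous f_lift
        bounded_linear.continuous_on[OF matrix_vector_mul_bounded_linear])
  have "norm (W \<epsilon>) < \<delta>" if "0 < \<delta>" "\<delta> \<le> 1" for \<delta>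
  proof (rule torus_path_lift_small[OF _ cont, of 0])
    show "W 0 = 0" by (simp add: W_def disp_zero)
    show "dist (torus_proj (W s)) 0 < \<delta>" if "s \<in> {-r<..<r}" for s
    proof -
      have "\<bar>s\<bar> < r" using that by auto
      then show ?thesis using W_proj \<open>0 < \<delta>\<close> by simp
    qed
  qed (use r assms that in auto)
  \<comment> \<open>A nonzero \<open>W \<epsilon>\<close> would have norm smaller than
    itself.\<close>
  from this[of "min 1 (norm (W \<epsilon>))"] have "W \<epsilon> = 0"
    by (cases "W \<epsilon> = 0") auto
  then show ?thesis by (simp add: W_def)
qed

lemma lift_H_S0:
  "\<bar>\<epsilon>\<bar> < r \<Longrightarrow> lift_H \<epsilon> (S0 *v x) = S0 *v lift_H \<epsilon> x - \<epsilon> *\<^sub>R f (torus_proj (lift_H \<epsilon> x))"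
  using disp_cat_map[of \<epsilon> x]
  by (simp add: lift_H_def cat_map_torus_proj matrix_vector_right_distrib)

section \<open>Uniform smallness and continuity of the lift\<close>

lemma C_powr_small:
  assumes "0 < e"
  obtains d where "0 < d" "\<And>s. 0 \<le> s \<Longrightarrow> s < d \<Longrightarrow> C * s powr \<beta> < e"
proof -
  have "((\<lambda>s. C * s powr \<beta>) \<longlongrightarrow> C * 0 powr \<beta>) (at_right 0)"
    using \<beta> by (intro tendsto_mult tendsto_const tendsto_powr2 tendsto_ident_at)
      (auto intro: eventually_mono[OF eventually_at_right_less])
  then have "\<forall>\<^sub>F s in at_right 0. C * s powr \<beta> < e"
    using assms \<beta> by (intro order_tendstoD(2)) auto
  then obtain d where d: "0 < d" "\<And>s. 0 < s \<Longrightarrow> s < d \<Longrightarrow> C * s powr \<beta> < e"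
    unfolding eventually_at_right_field by auto
  have "C * s powr \<beta> < e" if "0 \<le> s" "s < d" for s
    using d(2)[of s] that assms \<beta> by (cases "s = 0") auto
  with d(1) show ?thesis using that by blast
qed

text \<open>Equicontinuity upgrades the pointwise convergence \<open>H \<epsilon> p \<rightarrow> p\<close> to uniform convergence.\<close>

lemma H_uniformly_close:
  assumes "0 < \<delta>"
  obtains d where "0 < d" "d \<le> r" "\<And>\<epsilon> p. \<bar>\<epsilon>\<bar> < d \<Longrightarrow> dist (H \<epsilon> p) p < \<delta>"
proof -
  obtain e where e: "0 < e" "\<And>s. 0 \<le> s \<Longrightarrow> s < e \<Longrightarrow> C * s powr \<beta> < \<delta> / 3"
    using C_powr_small[of "\<delta> / 3"] assms by auto
  \<comment> \<open>The net is fine enough for the Hoelder bound to keep images within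
    \<open>\<delta> / 3\<close>, and for the net point itself to be within
    \<open>\<delta> / 3\<close>.\<close>
  have "0 < min e (\<delta> / 3)" using e(1) assms by simp
  then obtain A :: "torus2 set" where A: "finite A" "\<forall>p. \<exists>q\<in>A. dist p q < min e (\<delta> / 3)"
    using totally_bounded_torus by blast
  have "\<forall>\<^sub>F \<epsilon> in nhds 0. dist (H \<epsilon> q) q < \<delta> / 3" for q
  proof -
    have "isCont (\<lambda>\<epsilon>. disp \<epsilon> q) 0"
      using disp_continuous[of q] r by (simp add: continuous_on_eq_continuous_at)
    then have "((\<lambda>\<epsilon>. disp \<epsilon> q) \<longlongrightarrow> disp 0 q) (nhds 0)"
      using tendsto_at_iff_tendsto_nhds[of "\<lambda>\<epsilon>. disp \<epsilon> q"] by (simp add: isCont_def)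
    then have "\<forall>\<^sub>F \<epsilon> in nhds 0. dist (disp \<epsilon> q) 0 < \<delta> / 3"
      using tendstoD[of "\<lambda>\<epsilon>. disp \<epsilon> q" 0 "nhds 0" "\<delta> / 3"] assms by (simp add: disp_zero)
    moreover have "\<forall>\<^sub>F \<epsilon> in nhds 0. \<bar>\<epsilon>\<bar> < r"
      using r unfolding eventually_nhds_metric by (auto simp: dist_real_def)
    ultimately show ?thesis
    proof eventually_elim
      case (elim \<epsilon>)
      obtain x where x: "q = torus_proj x" using torus_proj_surj by blast
      have "dist (H \<epsilon> q) q \<le> dist (lift_H \<epsilon> x) x"
        using dist_torus2_le[of "lift_H \<epsilon> x" x] elim(2) by (simp add: torus_proj_lift_H x)
      with elim(1) show ?case by (simp add: lift_H_def dist_norm x)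
    qed
  qed
  then have "\<forall>\<^sub>F \<epsilon> in nhds 0. \<forall>q\<in>A. dist (H \<epsilon> q) q < \<delta> / 3"
    using A(1) by (intro eventually_ball_finite) auto
  then obtain d where d: "0 < d" "\<And>\<epsilon>. \<bar>\<epsilon>\<bar> < d \<Longrightarrow> \<forall>q\<in>A. dist (H \<epsilon> q) q < \<delta> / 3"
    unfolding eventually_nhds_metric by (auto simp: dist_real_def)
  have "dist (H \<epsilon> p) p < \<delta>" if "\<bar>\<epsilon>\<bar> < min d r" for \<epsilon> p
  proof -
    obtain q where q: "q \<in> A" "dist p q < min e (\<delta> / 3)" using A(2) by blast
    have "dist (H \<epsilon> p) (H \<epsilon> q) < \<delta> / 3"
      using H_hoelder[of \<epsilon> p q] e(2)[of "dist p q"] that q(2) by simp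
    moreover have "dist (H \<epsilon> q) q < \<delta> / 3" using d(2)[of \<epsilon>] that q(1) by simp
    moreover have "dist (H \<epsilon> p) p \<le> dist (H \<epsilon> p) (H \<epsilon> q) + (dist (H \<epsilon> q) q + dist q p)"
      using dist_triangle[of "H \<epsilon> p" p "H \<epsilon> q"] dist_triangle[of "H \<epsilon> q" p q] by simp
    ultimately show ?thesis using q(2) by (simp add: dist_commute)
  qed
  then show ?thesis using that[of "min d r"] d(1) r by simp
qed

text \<open>Closeness on the torus determines \<open>disp\<close> only up to the lattice. For fixed
  \<open>p\<close>, following \<open>disp s p\<close> from \<open>s = 0\<close> excludes a jump to
  another sheet, and the radius is uniform in \<open>p\<close>.\<close>

lemma disp_small:
  obtains d where "0 < d" "d \<le> r" "\<And>\<epsilon> p. \<bar>\<epsilon>\<bar> < d \<Longrightarrow> norm (disp \<epsilon> p) < 1"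
proof -
  obtain d where d: "0 < d" "d \<le> r" "\<And>\<epsilon> p. \<bar>\<epsilon>\<bar> < d \<Longrightarrow> dist (H \<epsilon> p) p < 1"
    using H_uniformly_close[of 1] by auto
  have "norm (disp \<epsilon> p) < 1" if "\<bar>\<epsilon>\<bar> < d" for \<epsilon> p
  proof (rule torus_path_lift_small[of "{-d<..<d}" _ 0])
    show "continuous_on {-d<..<d} (\<lambda>\<epsilon>. disp \<epsilon> p)"
      using d(2) by (intro continuous_on_subset[OF disp_continuous]) auto
    show "dist (torus_proj (disp s p)) 0 < 1" if "s \<in> {-d<..<d}" for s
    proof -
      have s: "\<bar>s\<bar> < d" using that by auto
      obtain z where z: "torus_proj z = H s p - p" "norm z < 1"
        using torus_dist_lift[OF d(3)[OF s]] .
      then have "torus_proj z = torus_proj (disp s p)" using H_disp[of s p] s d(2) by simp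
      then show ?thesis using dist_torus2_le[of z 0] z(2) by (simp add: torus_proj_zero)
    qed
  qed (use d(1) that disp_zero in auto)
  with d(1,2) show ?thesis using that by blast
qed

text \<open>The Hoelder bound gives a short representative \<open>z\<close> of the difference of
  images. It differs from the increment of the lift by a lattice vector of norm below
  \<open>4 < 2 * pi\<close>, so the two agree.\<close>

lemma isCont_lift_H:
  assumes \<epsilon>: "\<bar>\<epsilon>\<bar> < r" and bound: "\<And>p. norm (disp \<epsilon> p) < 1"
  shows "isCont (lift_H \<epsilon>) x"
  unfolding continuous_at_eps_delta
proof (intro allI impI)
  fix e :: real assume "0 < e"
  obtain d where d: "0 < d" "\<And>s. 0 \<le> s \<Longrightarrow> s < d \<Longrightarrow> C * s powr \<beta> < min 1 e"
    using C_powr_small[of "min 1 e"] \<open>0 < e\<close> by auto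
  have "dist (lift_H \<epsilon> y) (lift_H \<epsilon> x) < e" if y: "dist y x < min d 1" for y
  proof -
    have "dist (torus_proj y) (torus_proj x) < d"
      using dist_torus2_le[of y x] y by simp
    then have "dist (H \<epsilon> (torus_proj y)) (H \<epsilon> (torus_proj x)) < min 1 e"
      using H_hoelder[OF \<epsilon>, of "torus_proj y" "torus_proj x"]
        d(2)[of "dist (torus_proj y) (torus_proj x)"] by simp
    then obtain z where "torus_proj z = H \<epsilon> (torus_proj y) - H \<epsilon> (torus_proj x)" "norm z < min 1 e"
      by (rule torus_dist_lift)
    then have z: "torus_proj z = torus_proj (lift_H \<epsilon> y - lift_H \<epsilon> x)" "norm z < min 1 e"
      by (auto simp: torus_proj_diff torus_proj_lift_H[OF \<epsilon>])
    have "z - (lift_H \<epsilon> y - lift_H \<epsilon> x) =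
        (z - (y - x)) - (disp \<epsilon> (torus_proj y) - disp \<epsilon> (torus_proj x))"
      by (simp add: lift_H_def)
    also have "norm \<dots> \<le> norm (z - (y - x)) + norm (disp \<epsilon> (torus_proj y) - disp \<epsilon> (torus_proj x))"
      by (rule norm_triangle_ineq4)
    also have "\<dots> \<le> (norm z + norm (y - x)) +
        (norm (disp \<epsilon> (torus_proj y)) + norm (disp \<epsilon> (torus_proj x)))"
      by (intro add_mono norm_triangle_ineq4)
    also have "\<dots> < 2 * pi"
      using z(2) y bound[of "torus_proj y"] bound[of "torus_proj x"] pi_gt3
      by (simp add: dist_norm)
    finally have "z = lift_H \<epsilon> y - lift_H \<epsilon> x" using z(1) by (intro torus_proj_small_unique)
    then show ?thesis using z(2) by (simp add: dist_norm)
  qed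
  then show "\<exists>d>0. \<forall>y. dist y x < d \<longrightarrow> dist (lift_H \<epsilon> y) (lift_H \<epsilon> x) < e"
    using d(1) by (intro exI[of _ "min d 1"]) auto
qed

lemma lift_H_inj:
  assumes "\<bar>\<epsilon>\<bar> < r" "lift_H \<epsilon> x = lift_H \<epsilon> y" "norm (x - y) < 2 * pi"
  shows "x = y"
proof -
  have "H \<epsilon> (torus_proj x) = H \<epsilon> (torus_proj y)"
    using assms(1,2) by (simp flip: torus_proj_lift_H)
  then have "torus_proj x = torus_proj y"
    using H_bij[OF assms(1)] by (simp add: bij_is_inj inj_eq)
  then show ?thesis using assms(3) by (rule torus_proj_small_unique)
qed

text \<open>The series of differences is the difference of two convergent series, which turns the
  quotient into an increment of the lift.\<close>

lemma V_quot_lift_H: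
  assumes "\<bar>\<epsilon>\<bar> < r"
  shows "V_quot h v \<epsilon> (torus_proj x) t = (1 / t) *\<^sub>R (lift_H \<epsilon> (x + t *\<^sub>R v) - lift_H \<epsilon> x)"
  using suminf_diff[OF summable_h[OF assms] summable_h[OF assms],
      of "torus_proj (x + t *\<^sub>R v)" "torus_proj x"]
  by (simp add: V_quot_def lift_H_def disp_def torus_proj_add scaleR_diff_right)

end

section \<open>The eigenbasis of the cat map\<close>

lemma S0_symmetric: "(S0 *v x) \<bullet> y = x \<bullet> (S0 *v y)"
  by (simp add: S0_def inner_vec_def sum_2 matrix_vector_mult_def algebra_simps)

text \<open>The square of \<open>11/5\<close> is below 5.\<close>

lemma lambda_plus_ge: "8/5 \<le> lambda_plus"
  unfolding lambda_plus_def using real_le_rsqrt[of "11/5" 5] by (simp add: power2_eq_square)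

text \<open>The square of \<open>56/25\<close> exceeds 5, and
  \<open>(56/25 - 1) / 2 = 31/50\<close>.\<close>

lemma lambda_minus_bounds: "lambda_minus < 0" "\<bar>lambda_minus\<bar> \<le> 31/50"
  unfolding lambda_minus_def
  using real_less_rsqrt[of 1 5] real_le_lsqrt[of "56/25" 5] by (auto simp: power2_eq_square)

text \<open>Symmetry of \<open>S0\<close> makes eigenvectors for distinct eigenvalues orthogonal,
  and two orthonormal vectors span the plane.\<close>

lemma S0_eigenbasis_expand:
  assumes "norm w = 1" "S0 *v w = lambda_plus *\<^sub>R w" "norm v = 1" "S0 *v v = lambda_minus *\<^sub>R v"
  shows "z = (z \<bullet> w) *\<^sub>R w + (z \<bullet> v) *\<^sub>R v"
proof -
  have "lambda_plus * (w \<bullet> v) = lambda_minus * (w \<bullet> v)"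
    using S0_symmetric[of w v] assms by simp
  then have orth: "w \<bullet> v = 0"
    using lambda_plus_ge lambda_minus_bounds by auto
  then have ne: "w \<noteq> v" using assms(1) by auto
  have po: "pairwise orthogonal {w, v}"
    using orth by (auto simp: pairwise_def orthogonal_def inner_commute)
  then have "independent {w, v}"
    using assms(1,3) by (intro pairwise_orthogonal_independent) auto
  then have "UNIV \<subseteq> span {w, v}"
    using ne by (intro card_ge_dim_independent) auto
  then have "(\<Sum>i\<in>{w, v}. (z \<bullet> i) *\<^sub>R i) = z"
    using po assms(1,3) by (intro orthonormal_basis_expand) auto
  then show ?thesis using ne by simp
qed

section \<open>Existence of the limiting slope for the perturbed cat map\<close>

theorem theorem2:
  fixes f :: "torus2 \<Rightarrow> real^2"
    and H :: "real \<Rightarrow> torus2 \<Rightarrow> torus2"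
    and h :: "nat \<Rightarrow> torus2 \<Rightarrow> real^2"
    and v_plus v_minus :: "real^2"
  assumes "norm v_plus = 1" and "S0 *v v_plus = lambda_plus *\<^sub>R v_plus"
    and "norm v_minus = 1" and "S0 *v v_minus = lambda_minus *\<^sub>R v_minus"
    and "trig_polynomial f"
    and "structural_conjugacy f H h"
  shows "\<exists>D>0. \<forall>\<epsilon>. \<bar>\<epsilon>\<bar> < D \<longrightarrow> (\<forall>\<psi>.
           (\<forall>\<^sub>F t in at_right 0. V_quot h v_minus \<epsilon> \<psi> t \<bullet> v_minus \<noteq> 0) \<and>
           (\<exists>L::real. ((\<lambda>t. (V_quot h v_minus \<epsilon> \<psi> t \<bullet> v_plus) / (V_quot h v_minus \<epsilon> \<psi> t \<bullet> v_minus))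
              \<longlongrightarrow> L) (at_right 0)))"
proof -
  obtain F' :: "real^2 \<Rightarrow> real^2 \<Rightarrow> real^2" and L where
    F': "\<And>x. ((\<lambda>x. f (torus_proj x)) has_derivative F' x) (at x)"
      "\<And>x z. norm (F' x z) \<le> L * norm z"
    using trig_polynomial_bounded_derivative[OF assms(5)] by blast
  have L: "0 \<le> L"
    using order_trans[OF norm_ge_zero F'(2)[of 0 v_plus]] assms(1) by simp
  have "(0::real) < 1/2 \<and> (1/2::real) < 1" by simp
  then obtain C r where r: "0 < r" and conj: "\<And>\<epsilon>. \<bar>\<epsilon>\<bar> < r \<Longrightarrow>
      (\<exists>G. homeomorphism UNIV UNIV (H \<epsilon>) G) \<and>
      H \<epsilon> \<circ> cat_map \<circ> inv (H \<epsilon>) = perturbed_cat_map f \<epsilon> \<and>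
      (\<forall>\<phi> \<psi>. dist (H \<epsilon> \<phi>) (H \<epsilon> \<psi>) \<le> C * dist \<phi> \<psi> powr (1/2)) \<and>
      (\<forall>\<psi>. summable (\<lambda>k. \<epsilon> ^ Suc k *\<^sub>R h (Suc k) \<psi>) \<and>
         H \<epsilon> \<psi> = \<psi> + torus_proj (\<Sum>k. \<epsilon> ^ Suc k *\<^sub>R h (Suc k) \<psi>))"
    using assms(6) unfolding structural_conjugacy_def by blast
  interpret torus_conjugacy_family f H h C "1/2" r
  proof
    show "continuous_on UNIV (\<lambda>x. f (torus_proj x))"
      using F'(1) has_derivative_continuous by (intro continuous_at_imp_continuous_on) blast
    show "bij (H \<epsilon>)" if \<epsilon>: "\<bar>\<epsilon>\<bar> < r" for \<epsilon>
    proof -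
      obtain G where "homeomorphism UNIV UNIV (H \<epsilon>) G" using conj[OF \<epsilon>] by blast
      then have "G (H \<epsilon> p) = p" "H \<epsilon> (G p) = p" for p
        by (simp_all add: homeomorphism_def)
      then show ?thesis by (intro o_bij[of G]) (simp_all add: fun_eq_iff)
    qed
    show "H \<epsilon> \<circ> cat_map \<circ> inv (H \<epsilon>) = perturbed_cat_map f \<epsilon>" if "\<bar>\<epsilon>\<bar> < r" for \<epsilon>
      using conj[OF that] by (elim conjE)
    show "dist (H \<epsilon> p) (H \<epsilon> q) \<le> C * dist p q powr (1/2)" if "\<bar>\<epsilon>\<bar> < r" for \<epsilon> p q
      using conj[OF that] by (elim conjE allE)
    show "summable (\<lambda>k. \<epsilon> ^ Suc k *\<^sub>R h (Suc k) p)"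
      "H \<epsilon> p = p + torus_proj (\<Sum>k. \<epsilon> ^ Suc k *\<^sub>R h (Suc k) p)" if "\<bar>\<epsilon>\<bar> < r" for \<epsilon> p
      using conj[OF that] by blast+
  qed (use r in simp_all)
  obtain d where d: "0 < d" "d \<le> r" "\<And>\<epsilon> p. \<bar>\<epsilon>\<bar> < d \<Longrightarrow> norm (disp \<epsilon> p) < 1"
    using disp_small by blast
  \<comment> \<open>The first bound keeps displacements below 1, the second enforces
    \<open>\<bar>\<epsilon>\<bar> * L \<le> 1/20\<close>; the \<open>+ 1\<close> covers
    \<open>L = 0\<close>.\<close>
  define D where "D = min d (1 / (20 * (L + 1)))"
  have "0 < D" using d(1) L by (simp add: D_def)
  moreover have "(\<forall>\<^sub>F t in at_right 0. V_quot h v_minus \<epsilon> \<psi> t \<bullet> v_minus \<noteq> 0) \<and>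
      (\<exists>l::real. ((\<lambda>t. (V_quot h v_minus \<epsilon> \<psi> t \<bullet> v_plus) / (V_quot h v_minus \<epsilon> \<psi> t \<bullet> v_minus))
         \<longlongrightarrow> l) (at_right 0))" if "\<bar>\<epsilon>\<bar> < D" for \<epsilon> \<psi>
  proof -
    have \<epsilon>: "\<bar>\<epsilon>\<bar> < d" "\<bar>\<epsilon>\<bar> < r" "\<bar>\<epsilon>\<bar> < 1 / (20 * (L + 1))"
      using that d(2) by (auto simp: D_def)
    \<comment> \<open>Here \<open>B = 1\<close> comes from the displacement bound, and
      \<open>\<rho> = 1\<close> is admissible because a nonzero vector shorter than
      \<open>2 * pi\<close> is not a lattice vector.\<close>
    interpret perturbed_hyperbolic_conjugacy "(*v) S0" "\<lambda>x. f (torus_proj x)" "lift_H \<epsilon>" F'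
      v_plus v_minus lambda_plus lambda_minus \<epsilon> L 1 1
    proof
      show "\<bar>\<epsilon>\<bar> * L \<le> 1/20"
      proof -
        have "\<bar>\<epsilon>\<bar> * L \<le> 1 / (20 * (L + 1)) * (L + 1)"
          using \<epsilon>(3) L by (intro mult_mono) auto
        also have "\<dots> = 1/20" using L by simp
        finally show ?thesis .
      qed
      show "z = (z \<bullet> v_plus) *\<^sub>R v_plus + (z \<bullet> v_minus) *\<^sub>R v_minus" for z
        by (rule S0_eigenbasis_expand[OF assms(1-4)])
      show "lift_H \<epsilon> (x + t *\<^sub>R v_minus) \<noteq> lift_H \<epsilon> x" if "0 < \<bar>t\<bar>" "\<bar>t\<bar> < 1" for x t
        using lift_H_inj[OF \<epsilon>(2), of "x + t *\<^sub>R v_minus" x] that pi_gt3 assms(3) by auto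
      show "norm (lift_H \<epsilon> x - x) \<le> 1" for x
        using d(3)[OF \<epsilon>(1), of "torus_proj x"] by (simp add: lift_H_def)
      show "isCont (lift_H \<epsilon>) x" for x
        by (rule isCont_lift_H[OF \<epsilon>(2) d(3)[OF \<epsilon>(1)]])
      show "(S0 *v z) \<bullet> v_plus = lambda_plus * (z \<bullet> v_plus)"
        "(S0 *v z) \<bullet> v_minus = lambda_minus * (z \<bullet> v_minus)" for z
        using assms(2,4) by (simp_all add: S0_symmetric)
      show "lambda_minus \<noteq> 0" using lambda_minus_bounds(1) by simp
    qed (rule assms F' lambda_plus_ge lambda_minus_bounds lift_H_S0[OF \<epsilon>(2)] zero_less_one
        matrix_vector_right_distrib matrix_vector_mult_scaleR)+
    obtain x where x: "\<psi> = torus_proj x" using torus_proj_surj by blast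
    have V: "V_quot h v_minus \<epsilon> \<psi> t = (1 / t) *\<^sub>R incr x t" for t
      by (simp add: x V_quot_lift_H[OF \<epsilon>(2)] incr_def)
    have small: "\<forall>\<^sub>F t in at_right (0::real). 0 < t \<and> t < 1"
      unfolding eventually_at_right_field by (intro exI[of _ 1]) auto
    \<comment> \<open>This ensures that the limit is not an artefact of the convention for division
      by zero.\<close>
    then have nonzero: "\<forall>\<^sub>F t in at_right 0. V_quot h v_minus \<epsilon> \<psi> t \<bullet> v_minus \<noteq> 0"
      by eventually_elim (use incr_v_nonzero in \<open>auto simp: V\<close>)
    obtain l where "(slope x \<longlongrightarrow> l) (at 0)" using slope_convergent by blast
    then have "(slope x \<longlongrightarrow> l) (at_right 0)" by (simp add: filterlim_at_split)
    moreover have "\<forall>\<^sub>F t in at_right 0. slope x t =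
        (V_quot h v_minus \<epsilon> \<psi> t \<bullet> v_plus) / (V_quot h v_minus \<epsilon> \<psi> t \<bullet> v_minus)"
      using small by eventually_elim (simp add: V slope_def)
    ultimately have "((\<lambda>t. (V_quot h v_minus \<epsilon> \<psi> t \<bullet> v_plus) / (V_quot h v_minus \<epsilon> \<psi> t \<bullet> v_minus))
         \<longlongrightarrow> l) (at_right 0)"
      by (rule Lim_transform_eventually)
    with nonzero show ?thesis by blast
  qed
  ultimately show ?thesis by blast
qed

end
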